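(* Let $B$ be an infinite set with $2^{2^{|B|}}=(2^{|B|})^+$. Let $E$ be a regular lim-rim with basis $B$. Then: (a) $E$ is $|E|$-exact. (b) (Universality) If $M$ is a lim-rim over $B$ with $|M|\le|E|$ and $M'\subset M$ is a sub-lim-rim with $|M'|<|E|$, then every embedding of $M'$ in $E$ extends to an embedding of $M$ in $E$. (c) (Homogeneity) If $E_1,E_2$ are regular lim-rims with basis $B$, then every isomorphism between a sub-lim-rim of $E_1$ and a sub-lim-rim of $E_2$, both of cardinality $<2^{2^{|B|}}$, extends to an isomorphism $E_1\to E_2$. (d) (Uniqueness) Any two regular lim-rims with basis $B$ are isomorphic. (e) If $e,e'\in E$ have the same ultrafilter, i.e. $\{A\subset B:e\in{}^*A\}=\{A\subset B:e'\in{}^*A\}$, then there is an automorphism of $E$ exchanging them, in the sense that it maps $e$ to $e'$.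
   Context: $m^+$ denotes the successor cardinal of $m$. For sets $B,E$, a cylinder of $B^E$ is a subset of the form $\{\psi\in B^E:\psi|_J\in R\}$ with $J\subset E$ finite and $R\subset B^J$; the cylinders form a Boolean algebra. A lim-rim over $B$ is a set $E$ together with an ultrafilter $\mathcal L$ in the cylinder Boolean algebra of $B^E$. For $R\subset B^n$ put ${}^*R=\{(e_1,\dots,e_n)\in E^n:\{\psi\in B^E:(\psi_{e_1},\dots,\psi_{e_n})\in R\}\in\mathcal L\}$. The lim-rim is separated if $\{\psi:\psi_e=\psi_{e'}\}\in\mathcal L$ implies $e=e'$. For $\eta:I\to E$, let $\mathcal L_\eta$ be the ultrafilter in the cylinder algebra of $B^I$ consisting of the cylinders $C$ with $\{\psi\in B^E:\psi\circ\eta\in C\}\in\mathcal L$. For a cardinal $m$, $E$ is $m$-exact if for every set $I$ with $|I|<m$, every $i\notin I$, every $\eta:I\to E$, and every ultrafilter $\mathcal U$ in the cylinder algebra of $B^{I\cup\{i\}}$ whose projection to $B^I$ equals $\mathcal L_\eta$, there is an extension $\eta':I\cup\{i\}\to E$ of $\eta$ with $\mathcal L_{\eta'}=\mathcal U$. A regular lim-rim with basis $B$ is a separated lim-rim over $B$ of cardinality $2^{2^{|B|}}$ which is $(2^{|B|})^+$-exact. Any subset $E'\subset E$ is a lim-rim over $B$ (a sub-lim-rim) with ultrafilter $\mathcal L_\iota$, $\iota:E'\to E$ the inclusion. An isomorphism of lim-rims over $B$ is a bijection $f:(M,\mathcal L_M)\to(E,\mathcal L)$ respecting the ultrafilters,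 i.e. $\mathcal L_f=\mathcal L_M$; an automorphism is an isomorphism of $E$ onto itself. An embedding of a lim-rim $M$ over $B$ in $E$ is an isomorphism of $M$ onto a sub-lim-rim of $E$ (in particular it is injective).
   Formalization: In (b), M is additionally assumed to be separated: a non-separated M has no (injective) embedding in the separated lim-rim E, although its empty sub-lim-rim embeds, so (b) fails for such M. *)

theory Defs
  imports Main "HOL-Library.FuncSet"
begin

unbundle cardinal_syntax

text \<open>
  Throughout, \<open>B\<^sup>E\<close> is the set \<open>E \<rightarrow>\<^sub>E B\<close> of extensional functions. A lim-rim over \<open>B\<close> is given by
  its underlying set \<open>E\<close> and its ultrafilter \<open>L\<close>. Cardinals are those of the HOL library
  (\<open>card_of\<close>, \<open>cardSuc\<close>), so \<open>2\<^bsup>|B|\<^esup>\<close> is \<open>|Pow B|\<close> and \<open>m\<^sup>+\<close> is \<open>cardSuc m\<close>.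
\<close>

definition cylinders :: "'b set \<Rightarrow> 'e set \<Rightarrow> ('e \<Rightarrow> 'b) set set" where
  "cylinders B E =
     {{\<psi> \<in> E \<rightarrow>\<^sub>E B. restrict \<psi> J \<in> R} | J R. finite J \<and> J \<subseteq> E \<and> R \<subseteq> (J \<rightarrow>\<^sub>E B)}"

definition ultrafilter_in :: "'a set \<Rightarrow> 'a set set \<Rightarrow> 'a set set \<Rightarrow> bool" where
  "ultrafilter_in X \<A> U \<longleftrightarrow>
     U \<subseteq> \<A> \<and> X \<in> U \<and> {} \<notin> U \<and>
     (\<forall>C\<in>U. \<forall>D\<in>U. C \<inter> D \<in> U) \<and>
     (\<forall>C\<in>U. \<forall>D\<in>\<A>. C \<subseteq> D \<longrightarrow> D \<in> U) \<and>
     (\<forall>C\<in>\<A>. C \<in> U \<or> X - C \<in> U)"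

definition lim_rim :: "'b set \<Rightarrow> 'e set \<Rightarrow> ('e \<Rightarrow> 'b) set set \<Rightarrow> bool" where
  "lim_rim B E L \<longleftrightarrow> ultrafilter_in (E \<rightarrow>\<^sub>E B) (cylinders B E) L"

text \<open>The relation \<open>\<^sup>*R\<close> on \<open>E\<^sup>n\<close> for \<open>R \<subseteq> B\<^sup>n\<close>, with \<open>n\<close>-tuples as lists of length \<open>n\<close>.\<close>

definition star_rel ::
  "'b set \<Rightarrow> 'e set \<Rightarrow> ('e \<Rightarrow> 'b) set set \<Rightarrow> nat \<Rightarrow> 'b list set \<Rightarrow> 'e list set" where
  "star_rel B E L n R =
     {es. length es = n \<and> set es \<subseteq> E \<and> {\<psi> \<in> E \<rightarrow>\<^sub>E B. map \<psi> es \<in> R} \<in> L}"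

definition star_set ::
  "'b set \<Rightarrow> 'e set \<Rightarrow> ('e \<Rightarrow> 'b) set set \<Rightarrow> 'b set \<Rightarrow> 'e set" where
  "star_set B E L A = {e. [e] \<in> star_rel B E L 1 {[b] | b. b \<in> A}}"

definition separated :: "'b set \<Rightarrow> 'e set \<Rightarrow> ('e \<Rightarrow> 'b) set set \<Rightarrow> bool" where
  "separated B E L \<longleftrightarrow>
     (\<forall>e\<in>E. \<forall>e'\<in>E. {\<psi> \<in> E \<rightarrow>\<^sub>E B. \<psi> e = \<psi> e'} \<in> L \<longrightarrow> e = e')"

text \<open>The ultrafilter \<open>L\<^sub>\<eta>\<close> for \<open>\<eta> : I \<rightarrow> E\<close>; note \<open>compose I \<psi> \<eta> = (\<lambda>i\<in>I. \<psi> (\<eta> i))\<close>.\<close>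

definition induced ::
  "'b set \<Rightarrow> 'e set \<Rightarrow> ('e \<Rightarrow> 'b) set set \<Rightarrow> 'i set \<Rightarrow> ('i \<Rightarrow> 'e) \<Rightarrow> ('i \<Rightarrow> 'b) set set" where
  "induced B E L I \<eta> = {C \<in> cylinders B I. {\<psi> \<in> E \<rightarrow>\<^sub>E B. compose I \<psi> \<eta> \<in> C} \<in> L}"

text \<open>The projection of an ultrafilter on \<open>B\<^sup>K\<close> to \<open>B\<^sup>I\<close>, for \<open>I \<subseteq> K\<close>.\<close>

definition projection ::
  "'b set \<Rightarrow> 'i set \<Rightarrow> ('i \<Rightarrow> 'b) set set \<Rightarrow> 'i set \<Rightarrow> ('i \<Rightarrow> 'b) set set" where
  "projection B K U I = {C \<in> cylinders B I. {\<psi> \<in> K \<rightarrow>\<^sub>E B. restrict \<psi> I \<in> C} \<in> U}"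

text \<open>
  \<open>m\<close>-exactness. The index sets \<open>I\<close> range over subsets of the type underlying the cardinal \<open>m\<close>.
  This loses no generality: if \<open>|I| < m\<close> and \<open>i \<notin> I\<close>, with \<open>I\<close> in any type, then \<open>I\<close> is in bijection
  with a proper subset of \<open>Field m\<close>, and the bijection extends to \<open>i\<close> by a value outside that subset.
\<close>

definition exact :: "'i rel \<Rightarrow> 'b set \<Rightarrow> 'e set \<Rightarrow> ('e \<Rightarrow> 'b) set set \<Rightarrow> bool" where
  "exact m B E L \<longleftrightarrow>
     (\<forall>(I :: 'i set) i \<eta> U.
        |I| <o m \<and> i \<notin> I \<and> \<eta> \<in> I \<rightarrow> E \<and>
        ultrafilter_in (insert i I \<rightarrow>\<^sub>E B) (cylinders B (insert i I)) U \<and>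
        projection B (insert i I) U I = induced B E L I \<eta>
        \<longrightarrow> (\<exists>\<eta>' \<in> insert i I \<rightarrow> E.
               (\<forall>j\<in>I. \<eta>' j = \<eta> j) \<and> induced B E L (insert i I) \<eta>' = U))"

definition regular_lim_rim :: "'b set \<Rightarrow> 'e set \<Rightarrow> ('e \<Rightarrow> 'b) set set \<Rightarrow> bool" where
  "regular_lim_rim B E L \<longleftrightarrow>
     lim_rim B E L \<and> separated B E L \<and> |E| =o |Pow (Pow B)| \<and> exact (cardSuc |Pow B| ) B E L"

text \<open>The ultrafilter of the sub-lim-rim \<open>E' \<subseteq> E\<close>.\<close>

definition sub_ultrafilter ::
  "'b set \<Rightarrow> 'e set \<Rightarrow> ('e \<Rightarrow> 'b) set set \<Rightarrow> 'e set \<Rightarrow> ('e \<Rightarrow> 'b) set set" where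
  "sub_ultrafilter B E L E' = induced B E L E' (\<lambda>e. e)"

definition lim_rim_iso ::
  "'b set \<Rightarrow> 'm set \<Rightarrow> ('m \<Rightarrow> 'b) set set \<Rightarrow> 'e set \<Rightarrow> ('e \<Rightarrow> 'b) set set \<Rightarrow> ('m \<Rightarrow> 'e) \<Rightarrow> bool" where
  "lim_rim_iso B M LM E L f \<longleftrightarrow> bij_betw f M E \<and> induced B E L M f = LM"

definition lim_rim_embedding ::
  "'b set \<Rightarrow> 'm set \<Rightarrow> ('m \<Rightarrow> 'b) set set \<Rightarrow> 'e set \<Rightarrow> ('e \<Rightarrow> 'b) set set \<Rightarrow> ('m \<Rightarrow> 'e) \<Rightarrow> bool" where
  "lim_rim_embedding B M LM E L f \<longleftrightarrow>
     (\<exists>E'\<subseteq>E. lim_rim_iso B M LM E' (sub_ultrafilter B E L E') f)"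

end

theory Submission
  imports Defs
begin

text \<open>
  The argument is the one that shows saturated structures to be universal and homogeneous.

  A relation \<open>G \<subseteq> E1 \<times> E2\<close> is treated as an index set carrying the two families \<open>fst\<close> and \<open>snd\<close>; it
  is a partial isomorphism (\<open>partial_iso\<close>) if both families induce the same ultrafilter on \<open>B\<^sup>G\<close>.
  This notion is symmetric in \<open>E1\<close> and \<open>E2\<close>, and it has finite character because a cylinder looks
  at finitely many coordinates only (\<open>partial_iso_finite_character\<close>). If \<open>E2\<close> is \<open>\<kappa>\<close>-exact, a
  partial isomorphism with fewer than \<open>\<kappa>\<close> pairs can be extended to any further point \<open>x\<close> of \<open>E1\<close>
  (\<open>partial_iso_forth\<close>): the ultrafilter of \<open>x\<close> jointly with the first components is, read over the
  second components, an instance of the exactness of \<open>E2\<close>. By symmetry one can likewise extend to a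
  point of \<open>E2\<close> when \<open>E1\<close> is exact.

  Let \<open>\<kappa> = (2\<^bsup>|B|\<^esup>)\<^sup>+\<close>, so that the cardinal hypothesis gives \<open>|E| = \<kappa>\<close> for each regular lim-rim
  \<open>E\<close>. Part (a) is then the given exactness, carried to other index sets. Everything else is a
  transfinite construction of length at most \<open>\<kappa>\<close>: each stage contains fewer than \<open>\<kappa>\<close> pairs, the
  one-step extension applies at successors, and finite character takes care of limits
  (\<open>finite_character_saturation\<close>). Meeting every point of \<open>M\<close> gives universality. Meeting every
  point of \<open>E1\<close> and of \<open>E2\<close> gives homogeneity, and separatedness makes the resulting relation a
  bijection. Uniqueness starts from the empty partial isomorphism, and (e) starts from
  \<open>{(e, e')}\<close>.
\<close>

section \<open>Cylinders and induced ultrafilters\<close>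

text \<open>A cylinder is a set whose membership depends on finitely many coordinates; in this form the
relation on the finite set of coordinates need not be handled.\<close>

lemma cylinder_supportE:
  fixes B :: "'b set" and E :: "'e set"
  assumes "C \<in> cylinders B E"
  obtains J where "finite J" "J \<subseteq> E"
    "\<forall>\<phi>\<in>E \<rightarrow>\<^sub>E B. \<forall>\<psi>\<in>E \<rightarrow>\<^sub>E B. (\<forall>j\<in>J. \<phi> j = \<psi> j) \<longrightarrow> (\<phi> \<in> C \<longleftrightarrow> \<psi> \<in> C)"
proof -
  obtain J R where J: "finite J" "J \<subseteq> E"
    and C: "C = {\<psi> \<in> E \<rightarrow>\<^sub>E B. restrict \<psi> J \<in> R}"
    using assms unfolding cylinders_def by blast
  show thesis
  proof (rule that[OF J], intro ballI impI)
    fix \<phi> \<psi> :: "'e \<Rightarrow> 'b"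
    assume *: "\<phi> \<in> E \<rightarrow>\<^sub>E B" "\<psi> \<in> E \<rightarrow>\<^sub>E B" and "\<forall>j\<in>J. \<phi> j = \<psi> j"
    then have "restrict \<phi> J = restrict \<psi> J" by (intro restrict_ext) simp
    then show "\<phi> \<in> C \<longleftrightarrow> \<psi> \<in> C" using * by (simp add: C)
  qed
qed

lemma cylindersI:
  assumes sub: "C \<subseteq> E \<rightarrow>\<^sub>E B" and J: "finite J" "J \<subseteq> E"
    and dep: "\<And>\<phi> \<psi>. \<phi> \<in> E \<rightarrow>\<^sub>E B \<Longrightarrow> \<psi> \<in> E \<rightarrow>\<^sub>E B \<Longrightarrow> (\<And>j. j \<in> J \<Longrightarrow> \<phi> j = \<psi> j) \<Longrightarrow>
      \<phi> \<in> C \<Longrightarrow> \<psi> \<in> C"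
  shows "C \<in> cylinders B E"
proof -
  define R where "R = (\<lambda>\<psi>. restrict \<psi> J) ` C"
  have "R \<subseteq> J \<rightarrow>\<^sub>E B"
    using sub J(2) unfolding R_def by (auto simp: subset_iff PiE_iff)
  moreover have "C = {\<psi> \<in> E \<rightarrow>\<^sub>E B. restrict \<psi> J \<in> R}"
  proof (intro equalityI subsetI)
    fix \<psi> assume "\<psi> \<in> {\<psi> \<in> E \<rightarrow>\<^sub>E B. restrict \<psi> J \<in> R}"
    then obtain \<phi> where *: "\<psi> \<in> E \<rightarrow>\<^sub>E B" "\<phi> \<in> C" and eq: "restrict \<psi> J = restrict \<phi> J"
      unfolding R_def by auto
    have "\<phi> j = \<psi> j" if "j \<in> J" for j
      using fun_cong[OF eq, of j] that by simp
    then show "\<psi> \<in> C" using dep[of \<phi> \<psi>] * sub by blast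
  qed (use sub in \<open>auto simp: R_def\<close>)
  ultimately show ?thesis using J unfolding cylinders_def by blast
qed

lemma cylinders_subset: "C \<in> cylinders B E \<Longrightarrow> C \<subseteq> E \<rightarrow>\<^sub>E B"
  by (auto simp: cylinders_def)

lemma cylinders_top: "(E \<rightarrow>\<^sub>E B) \<in> cylinders B E"
  by (rule cylindersI[where J = "{}"]) auto

lemma cylinders_Int:
  assumes "C \<in> cylinders B E" "D \<in> cylinders B E"
  shows "C \<inter> D \<in> cylinders B E"
proof -
  obtain J where J: "finite J" "J \<subseteq> E"
    "\<forall>\<phi>\<in>E \<rightarrow>\<^sub>E B. \<forall>\<psi>\<in>E \<rightarrow>\<^sub>E B. (\<forall>j\<in>J. \<phi> j = \<psi> j) \<longrightarrow> (\<phi> \<in> C \<longleftrightarrow> \<psi> \<in> C)"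
    by (rule cylinder_supportE[OF assms(1)])
  obtain K where K: "finite K" "K \<subseteq> E"
    "\<forall>\<phi>\<in>E \<rightarrow>\<^sub>E B. \<forall>\<psi>\<in>E \<rightarrow>\<^sub>E B. (\<forall>j\<in>K. \<phi> j = \<psi> j) \<longrightarrow> (\<phi> \<in> D \<longleftrightarrow> \<psi> \<in> D)"
    by (rule cylinder_supportE[OF assms(2)])
  show ?thesis
  proof (rule cylindersI[where J = "J \<union> K"])
    fix \<phi> \<psi> assume *: "\<phi> \<in> E \<rightarrow>\<^sub>E B" "\<psi> \<in> E \<rightarrow>\<^sub>E B" "\<And>j. j \<in> J \<union> K \<Longrightarrow> \<phi> j = \<psi> j" "\<phi> \<in> C \<inter> D"
    show "\<psi> \<in> C \<inter> D"
      using J(3)[rule_format, OF *(1,2)] K(3)[rule_format, OF *(1,2)] * by simp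
  qed (use J(1,2) K(1,2) cylinders_subset[OF assms(1)] in auto)
qed

lemma cylinders_Diff:
  assumes "C \<in> cylinders B E"
  shows "(E \<rightarrow>\<^sub>E B) - C \<in> cylinders B E"
proof -
  obtain J where J: "finite J" "J \<subseteq> E"
    "\<forall>\<phi>\<in>E \<rightarrow>\<^sub>E B. \<forall>\<psi>\<in>E \<rightarrow>\<^sub>E B. (\<forall>j\<in>J. \<phi> j = \<psi> j) \<longrightarrow> (\<phi> \<in> C \<longleftrightarrow> \<psi> \<in> C)"
    by (rule cylinder_supportE[OF assms])
  show ?thesis
  proof (rule cylindersI[OF _ J(1,2)])
    fix \<phi> \<psi> assume "\<phi> \<in> E \<rightarrow>\<^sub>E B" "\<psi> \<in> E \<rightarrow>\<^sub>E B" "\<And>j. j \<in> J \<Longrightarrow> \<phi> j = \<psi> j"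
      "\<phi> \<in> (E \<rightarrow>\<^sub>E B) - C"
    then show "\<psi> \<in> (E \<rightarrow>\<^sub>E B) - C" using J(3)[rule_format, of \<phi> \<psi>] by simp
  qed auto
qed

lemma compose_PiE: "\<eta> \<in> I \<rightarrow> E \<Longrightarrow> \<psi> \<in> E \<rightarrow>\<^sub>E B \<Longrightarrow> compose I \<psi> \<eta> \<in> I \<rightarrow>\<^sub>E B"
  by (auto simp: compose_def)

lemma restrict_compose: "J \<subseteq> I \<Longrightarrow> restrict (compose I \<psi> \<eta>) J = compose J \<psi> \<eta>"
  by (auto simp: compose_def restrict_def fun_eq_iff)

lemma cylinders_preimage:
  assumes \<eta>: "\<eta> \<in> I \<rightarrow> E" and C: "C \<in> cylinders B I"
  shows "{\<psi> \<in> E \<rightarrow>\<^sub>E B. compose I \<psi> \<eta> \<in> C} \<in> cylinders B E"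
proof -
  obtain J where J: "finite J" "J \<subseteq> I"
    "\<forall>\<phi>\<in>I \<rightarrow>\<^sub>E B. \<forall>\<psi>\<in>I \<rightarrow>\<^sub>E B. (\<forall>j\<in>J. \<phi> j = \<psi> j) \<longrightarrow> (\<phi> \<in> C \<longleftrightarrow> \<psi> \<in> C)"
    by (rule cylinder_supportE[OF C])
  show ?thesis
  proof (rule cylindersI[where J = "\<eta> ` J"])
    fix \<phi> \<psi>
    assume *: "\<phi> \<in> E \<rightarrow>\<^sub>E B" "\<psi> \<in> E \<rightarrow>\<^sub>E B" "\<And>j. j \<in> \<eta> ` J \<Longrightarrow> \<phi> j = \<psi> j"
      "\<phi> \<in> {\<psi> \<in> E \<rightarrow>\<^sub>E B. compose I \<psi> \<eta> \<in> C}"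
    have "compose I \<phi> \<eta> j = compose I \<psi> \<eta> j" if "j \<in> J" for j
      using that J(2) *(3) by (auto simp: compose_def)
    then show "\<psi> \<in> {\<psi> \<in> E \<rightarrow>\<^sub>E B. compose I \<psi> \<eta> \<in> C}"
      using J(3)[rule_format, OF compose_PiE[OF \<eta> *(1)] compose_PiE[OF \<eta> *(2)]] *(2,4) by simp
  qed (use J(1,2) \<eta> in auto)
qed

lemma lim_rimD:
  assumes "lim_rim B E L"
  shows "L \<subseteq> cylinders B E" "(E \<rightarrow>\<^sub>E B) \<in> L" "{} \<notin> L"
    "C \<in> L \<Longrightarrow> D \<in> L \<Longrightarrow> C \<inter> D \<in> L"
    "C \<in> L \<Longrightarrow> D \<in> cylinders B E \<Longrightarrow> C \<subseteq> D \<Longrightarrow> D \<in> L"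
    "C \<in> cylinders B E \<Longrightarrow> C \<in> L \<or> (E \<rightarrow>\<^sub>E B) - C \<in> L"
  using assms unfolding lim_rim_def ultrafilter_in_def by blast+

lemma ultrafilter_induced:
  assumes L: "lim_rim B E L" and \<eta>: "\<eta> \<in> I \<rightarrow> E"
  shows "ultrafilter_in (I \<rightarrow>\<^sub>E B) (cylinders B I) (induced B E L I \<eta>)"
proof -
  let ?p = "\<lambda>C. {\<psi> \<in> E \<rightarrow>\<^sub>E B. compose I \<psi> \<eta> \<in> C}"
  note U = lim_rimD[OF L] and cyl = cylinders_preimage[OF \<eta>]
  have top: "?p (I \<rightarrow>\<^sub>E B) = (E \<rightarrow>\<^sub>E B)" using compose_PiE[OF \<eta>] by blast
  have int: "?p (C \<inter> D) = ?p C \<inter> ?p D" for C D by blast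
  have diff: "?p ((I \<rightarrow>\<^sub>E B) - C) = (E \<rightarrow>\<^sub>E B) - ?p C" for C using compose_PiE[OF \<eta>] by blast
  have mem: "C \<in> induced B E L I \<eta> \<longleftrightarrow> C \<in> cylinders B I \<and> ?p C \<in> L" for C
    by (simp add: induced_def)
  show ?thesis unfolding ultrafilter_in_def
  proof (intro conjI ballI impI)
    show "induced B E L I \<eta> \<subseteq> cylinders B I" by (auto simp: mem)
    show "(I \<rightarrow>\<^sub>E B) \<in> induced B E L I \<eta>" unfolding mem top using U(2) cylinders_top by blast
    show "{} \<notin> induced B E L I \<eta>" using U(3) by (simp add: mem)
    show "C \<inter> D \<in> induced B E L I \<eta>" if "C \<in> induced B E L I \<eta>" "D \<in> induced B E L I \<eta>" for C D
      using that U(4)[of "?p C" "?p D"] cylinders_Int[of C B I D] unfolding mem int by simp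
    show "D \<in> induced B E L I \<eta>"
      if "C \<in> induced B E L I \<eta>" "D \<in> cylinders B I" "C \<subseteq> D" for C D
    proof -
      have "?p C \<subseteq> ?p D" using that(3) by auto
      then show ?thesis using that(1,2) U(5)[OF _ cyl[OF that(2)]] unfolding mem by blast
    qed
    show "C \<in> induced B E L I \<eta> \<or> (I \<rightarrow>\<^sub>E B) - C \<in> induced B E L I \<eta>" if "C \<in> cylinders B I" for C
      using that U(6)[OF cyl[OF that]] cylinders_Diff[OF that] unfolding mem diff by blast
  qed
qed

lemma induced_cong:
  fixes B :: "'b set" and E :: "'e set"
  assumes "\<And>i. i \<in> I \<Longrightarrow> \<eta> i = \<eta>' i"
  shows "induced B E L I \<eta> = induced B E L I \<eta>'"
proof -
  have "compose I \<psi> \<eta> = compose I \<psi> \<eta>'" for \<psi> :: "'e \<Rightarrow> 'b"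
    using assms by (auto simp: compose_def restrict_def)
  then show ?thesis by (simp add: induced_def)
qed

lemma induced_induced:
  fixes B :: "'b set" and E :: "'e set"
  assumes \<eta>: "\<eta> \<in> I \<rightarrow> E" and h: "h \<in> I' \<rightarrow> I"
  shows "induced B I (induced B E L I \<eta>) I' h = induced B E L I' (\<lambda>i. \<eta> (h i))"
proof -
  have "compose I' (compose I \<psi> \<eta>) h = compose I' \<psi> (\<lambda>i. \<eta> (h i))" for \<psi> :: "'e \<Rightarrow> 'b"
    using h by (auto simp: compose_def restrict_def fun_eq_iff)
  then have "{\<psi> \<in> E \<rightarrow>\<^sub>E B. compose I \<psi> \<eta> \<in> {\<phi> \<in> I \<rightarrow>\<^sub>E B. compose I' \<phi> h \<in> C}}
      = {\<psi> \<in> E \<rightarrow>\<^sub>E B. compose I' \<psi> (\<lambda>i. \<eta> (h i)) \<in> C}" for C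
    using compose_PiE[OF \<eta>, of _ B] by (simp cong: conj_cong)
  then show ?thesis
    using cylinders_preimage[OF h, of _ B] by (simp add: induced_def cong: conj_cong)
qed

lemma induced_id:
  assumes "lim_rim B E L"
  shows "induced B E L E (\<lambda>e. e) = L"
proof -
  have eq: "compose E \<psi> (\<lambda>e. e) = \<psi>" if "\<psi> \<in> E \<rightarrow>\<^sub>E B" for \<psi>
    using that by (auto simp: compose_def restrict_def fun_eq_iff PiE_iff extensional_def)
  have "{\<psi> \<in> E \<rightarrow>\<^sub>E B. compose E \<psi> (\<lambda>e. e) \<in> C} = C" if "C \<in> cylinders B E" for C
    using cylinders_subset[OF that] by (auto simp: eq subset_iff)
  then show ?thesis
    using lim_rimD(1)[OF assms] by (auto simp: induced_def)
qed

lemma projection_eq_induced: "projection B K U I = induced B K U I (\<lambda>i. i)"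
  by (simp add: projection_def induced_def compose_def)

lemma induced_reindex:
  assumes "a \<in> I \<rightarrow> E1" "b \<in> I \<rightarrow> E2" "h \<in> I' \<rightarrow> I"
    and "induced B E1 L1 I a = induced B E2 L2 I b"
  shows "induced B E1 L1 I' (\<lambda>i. a (h i)) = induced B E2 L2 I' (\<lambda>i. b (h i))"
  using induced_induced[OF assms(1,3), of B L1] induced_induced[OF assms(2,3), of B L2] assms(4)
  by simp

section \<open>Realizing ultrafilters in an exact lim-rim\<close>

text \<open>
  Exactness is applied to the ultrafilter that \<open>a\<close> and \<open>x\<close> induce; every ultrafilter over the
  extended index set arises so, with that index set itself as \<open>E1\<close>. Since the index sets in the
  definition of exactness live in the type of the cardinal \<open>m\<close>, the family is first carried into
  \<open>Field m\<close>, where \<open>|I| < m\<close> leaves a value free for the new index.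
\<close>

lemma exact_realizes:
  fixes m :: "'i rel" and I :: "'j set"
  assumes ex: "exact m B E2 L2" and m: "Card_order m" and I: "|I| <o m" and i: "i \<notin> I"
    and L1: "lim_rim B E1 L1" and a: "a \<in> I \<rightarrow> E1" and b: "b \<in> I \<rightarrow> E2" and x: "x \<in> E1"
    and eq: "induced B E1 L1 I a = induced B E2 L2 I b"
  shows "\<exists>y\<in>E2. induced B E1 L1 (insert i I) (a(i := x)) = induced B E2 L2 (insert i I) (b(i := y))"
proof -
  have "|I| \<le>o |Field m|"
    using ordLess_imp_ordLeq[OF I] card_of_Field_ordIso[OF m]
      ordIso_symmetric ordLeq_ordIso_trans by blast
  then obtain h where h: "inj_on h I" "h ` I \<subseteq> Field m"
    using card_of_ordLeq[of I "Field m"] by blast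
  have hI: "|h ` I| <o m" using card_of_image I by (rule ordLeq_ordLess_trans)
  have "h ` I \<noteq> Field m"
    using hI card_of_Field_ordIso[OF m] not_ordLess_ordIso by metis
  then obtain i0 where i0: "i0 \<notin> h ` I" using h(2) by blast
  define k where "k = inv_into I h"
  have k: "k \<in> h ` I \<rightarrow> I" unfolding k_def by (auto intro: inv_into_into)
  have kh: "k (h j) = j" if "j \<in> I" for j using h(1) that by (simp add: k_def)
  define c where "c = (\<lambda>j. a (k j))(i0 := x)"
  define U where "U = induced B E1 L1 (insert i0 (h ` I)) c"
  have c: "c \<in> insert i0 (h ` I) \<rightarrow> E1" using x by (auto simp: c_def intro!: funcset_mem[OF a] funcset_mem[OF k])
  have "projection B (insert i0 (h ` I)) U (h ` I) = induced B E1 L1 (h ` I) c"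
    unfolding U_def projection_eq_induced by (rule induced_induced[OF c]) auto
  also have "\<dots> = induced B E1 L1 (h ` I) (\<lambda>j. a (k j))"
    by (rule induced_cong) (use i0 in \<open>auto simp: c_def\<close>)
  also have "\<dots> = induced B E2 L2 (h ` I) (\<lambda>j. b (k j))"
    by (rule induced_reindex[OF a b k eq])
  finally have pr: "projection B (insert i0 (h ` I)) U (h ` I) = \<dots>" .
  have bk: "(\<lambda>j. b (k j)) \<in> h ` I \<rightarrow> E2" by (auto intro!: funcset_mem[OF b] funcset_mem[OF k])
  obtain \<eta> where \<eta>: "\<eta> \<in> insert i0 (h ` I) \<rightarrow> E2" "\<forall>j\<in>h ` I. \<eta> j = b (k j)"
    and \<eta>U: "induced B E2 L2 (insert i0 (h ` I)) \<eta> = U"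
    using ex[unfolded exact_def, rule_format, of "h ` I" i0 "\<lambda>j. b (k j)" U]
      hI i0 bk pr ultrafilter_induced[OF L1 c, folded U_def] by blast
  define g where "g = h(i := i0)"
  have g: "g \<in> insert i I \<rightarrow> insert i0 (h ` I)" unfolding g_def by auto
  have "induced B E1 L1 (insert i I) (\<lambda>j. c (g j)) = induced B E2 L2 (insert i I) (\<lambda>j. \<eta> (g j))"
    by (rule induced_reindex[OF c \<eta>(1) g]) (simp add: \<eta>U U_def)
  moreover have "induced B E1 L1 (insert i I) (\<lambda>j. c (g j)) = induced B E1 L1 (insert i I) (a(i := x))"
    by (rule induced_cong) (use i0 i in \<open>auto simp: c_def g_def kh\<close>)
  moreover have "induced B E2 L2 (insert i I) (\<lambda>j. \<eta> (g j)) =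
      induced B E2 L2 (insert i I) (b(i := \<eta> i0))"
    by (rule induced_cong) (use i0 i \<eta>(2) in \<open>auto simp: g_def kh\<close>)
  moreover have "\<eta> i0 \<in> E2" using \<eta>(1) by auto
  ultimately show ?thesis by auto
qed

lemma exact_transfer:
  fixes m :: "'i rel" and m' :: "'j rel"
  assumes ex: "exact m B E L" and m: "Card_order m" and le: "m' \<le>o m"
  shows "exact m' B E L"
  unfolding exact_def
proof (intro allI impI, elim conjE)
  fix I :: "'j set" and i \<eta> U
  assume I: "|I| <o m'" and i: "i \<notin> I" and \<eta>: "\<eta> \<in> I \<rightarrow> E"
    and "ultrafilter_in (insert i I \<rightarrow>\<^sub>E B) (cylinders B (insert i I)) U"
    and pr: "projection B (insert i I) U I = induced B E L I \<eta>"
  then have U: "lim_rim B (insert i I) U" by (simp add: lim_rim_def)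
  obtain y where y: "y \<in> E"
    and eq: "induced B (insert i I) U (insert i I) ((\<lambda>j. j)(i := i)) =
      induced B E L (insert i I) (\<eta>(i := y))"
    using exact_realizes[OF ex m ordLess_ordLeq_trans[OF I le] i U _ \<eta>, of "\<lambda>j. j" i] pr
    unfolding projection_eq_induced by auto
  have "induced B E L (insert i I) (\<eta>(i := y)) = U"
    using eq induced_id[OF U] by (simp add: fun_upd_idem)
  then show "\<exists>\<eta>'\<in>insert i I \<rightarrow> E. (\<forall>j\<in>I. \<eta>' j = \<eta> j) \<and> induced B E L (insert i I) \<eta>' = U"
    using \<eta> y i by (intro bexI[of _ "\<eta>(i := y)"]) auto
qed

section \<open>Partial isomorphisms\<close>

definition partial_iso ::
  "'b set \<Rightarrow> 'm set \<Rightarrow> ('m \<Rightarrow> 'b) set set \<Rightarrow> 'e set \<Rightarrow> ('e \<Rightarrow> 'b) set set \<Rightarrow> ('m \<times> 'e) set \<Rightarrow> bool" where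
  "partial_iso B E1 L1 E2 L2 G \<longleftrightarrow>
     G \<subseteq> E1 \<times> E2 \<and> induced B E1 L1 G fst = induced B E2 L2 G snd"

lemma partial_iso_reindex:
  assumes "a \<in> I \<rightarrow> E1" "b \<in> I \<rightarrow> E2" "induced B E1 L1 I a = induced B E2 L2 I b"
    and h: "h \<in> G \<rightarrow> I" and ab: "\<And>p. p \<in> G \<Longrightarrow> p = (a (h p), b (h p))"
  shows "partial_iso B E1 L1 E2 L2 G"
proof -
  have "induced B E1 L1 G fst = induced B E1 L1 G (\<lambda>p. a (h p))"
    by (rule induced_cong) (metis ab fst_conv)
  also have "\<dots> = induced B E2 L2 G (\<lambda>p. b (h p))"
    by (rule induced_reindex) fact+
  also have "\<dots> = induced B E2 L2 G snd"
    by (rule induced_cong) (metis ab snd_conv)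
  finally have "induced B E1 L1 G fst = induced B E2 L2 G snd" .
  moreover have "p \<in> E1 \<times> E2" if "p \<in> G" for p
    using ab[OF that] funcset_mem[OF assms(1) funcset_mem[OF h that]]
      funcset_mem[OF assms(2) funcset_mem[OF h that]] by (metis mem_Sigma_iff)
  ultimately show ?thesis unfolding partial_iso_def by blast
qed

lemma partial_iso_funcset:
  assumes "partial_iso B E1 L1 E2 L2 G"
  shows "fst \<in> G \<rightarrow> E1" "snd \<in> G \<rightarrow> E2"
  using assms by (auto simp: partial_iso_def)

lemma partial_iso_subset:
  assumes "partial_iso B E1 L1 E2 L2 G" "F \<subseteq> G"
  shows "partial_iso B E1 L1 E2 L2 F"
  by (rule partial_iso_reindex[where h = "\<lambda>p. p", OF partial_iso_funcset[OF assms(1)]])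
    (use assms in \<open>auto simp: partial_iso_def\<close>)

lemma partial_iso_converse:
  assumes "partial_iso B E1 L1 E2 L2 G"
  shows "partial_iso B E2 L2 E1 L1 (G\<inverse>)"
  by (rule partial_iso_reindex[where h = prod.swap, OF partial_iso_funcset(2,1)[OF assms]])
    (use assms in \<open>auto simp: partial_iso_def\<close>)

text \<open>A cylinder over \<open>G\<close> is the inverse image of one over the finite set of coordinates that it
  depends on.\<close>

lemma partial_iso_finite_character:
  fixes B :: "'b set"
  shows "partial_iso B E1 L1 E2 L2 G \<longleftrightarrow> (\<forall>F\<subseteq>G. finite F \<longrightarrow> partial_iso B E1 L1 E2 L2 F)"
proof (intro iffI allI impI)
  assume fin: "\<forall>F\<subseteq>G. finite F \<longrightarrow> partial_iso B E1 L1 E2 L2 F"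
  have sub: "p \<in> E1 \<times> E2" if "p \<in> G" for p
    using fin[rule_format, of "{p}"] that by (auto simp: partial_iso_def)
  then have GE: "fst \<in> G \<rightarrow> E1" "snd \<in> G \<rightarrow> E2" by fastforce+
  have "C \<in> induced B E1 L1 G fst \<longleftrightarrow> C \<in> induced B E2 L2 G snd" if C: "C \<in> cylinders B G" for C
  proof -
    obtain J R where J: "finite J" "J \<subseteq> G" and R: "R \<subseteq> J \<rightarrow>\<^sub>E B"
      and Ceq: "C = {\<psi> \<in> G \<rightarrow>\<^sub>E B. restrict \<psi> J \<in> R}"
      using C unfolding cylinders_def by blast
    have "R = {\<psi> \<in> J \<rightarrow>\<^sub>E B. restrict \<psi> J \<in> R}"
      using R by (auto simp: PiE_restrict)
    then have Rcyl: "R \<in> cylinders B J"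
      using J(1) R unfolding cylinders_def by blast
    have "C \<in> induced B E1 L1 G fst \<longleftrightarrow> R \<in> induced B E1 L1 J fst"
    proof -
      have "{\<psi> \<in> E1 \<rightarrow>\<^sub>E B. compose G \<psi> fst \<in> C} = {\<psi> \<in> E1 \<rightarrow>\<^sub>E B. compose J \<psi> fst \<in> R}"
        using compose_PiE[of fst G E1 _ B] GE unfolding Ceq
        by (simp add: restrict_compose[OF J(2)] cong: conj_cong)
      then show ?thesis using C Rcyl by (simp add: induced_def)
    qed
    moreover have "C \<in> induced B E2 L2 G snd \<longleftrightarrow> R \<in> induced B E2 L2 J snd"
    proof -
      have "{\<psi> \<in> E2 \<rightarrow>\<^sub>E B. compose G \<psi> snd \<in> C} = {\<psi> \<in> E2 \<rightarrow>\<^sub>E B. compose J \<psi> snd \<in> R}"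
        using compose_PiE[of snd G E2 _ B] GE unfolding Ceq
        by (simp add: restrict_compose[OF J(2)] cong: conj_cong)
      then show ?thesis using C Rcyl by (simp add: induced_def)
    qed
    ultimately show ?thesis using fin J by (simp add: partial_iso_def)
  qed
  then have "induced B E1 L1 G fst = induced B E2 L2 G snd"
    by (auto simp: induced_def)
  then show "partial_iso B E1 L1 E2 L2 G" using sub by (auto simp: partial_iso_def)
qed (rule partial_iso_subset)

text \<open>The cylinder \<open>\<phi> (x, y) = \<phi> (x, y')\<close> is everything on the side of the first components.\<close>

lemma partial_iso_functional:
  assumes G: "partial_iso B E1 L1 E2 L2 G" and L1: "lim_rim B E1 L1" and sep: "separated B E2 L2"
    and xy: "(x, y) \<in> G" "(x, y') \<in> G"
  shows "y = y'"
proof -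
  define C where "C = {\<phi> \<in> G \<rightarrow>\<^sub>E B. \<phi> (x, y) = \<phi> (x, y')}"
  have cyl: "C \<in> cylinders B G"
    by (rule cylindersI[where J = "{(x, y), (x, y')}"]) (use xy in \<open>auto simp: C_def\<close>)
  have "{\<psi> \<in> E1 \<rightarrow>\<^sub>E B. compose G \<psi> fst \<in> C} = (E1 \<rightarrow>\<^sub>E B)"
    using compose_PiE[OF partial_iso_funcset(1)[OF G], of _ B] xy
    by (auto simp: C_def compose_def simp del: PiE_iff)
  then have "C \<in> induced B E1 L1 G fst"
    using cyl lim_rimD(2)[OF L1] by (simp add: induced_def)
  then have "C \<in> induced B E2 L2 G snd" using G by (simp add: partial_iso_def)
  moreover have "{\<psi> \<in> E2 \<rightarrow>\<^sub>E B. compose G \<psi> snd \<in> C} = {\<psi> \<in> E2 \<rightarrow>\<^sub>E B. \<psi> y = \<psi> y'}"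
    using compose_PiE[OF partial_iso_funcset(2)[OF G], of _ B] xy
    by (auto simp: C_def compose_def simp del: PiE_iff)
  ultimately have "{\<psi> \<in> E2 \<rightarrow>\<^sub>E B. \<psi> y = \<psi> y'} \<in> L2" by (simp add: induced_def)
  moreover have "y \<in> E2" "y' \<in> E2" using G xy by (auto simp: partial_iso_def)
  ultimately show ?thesis using sep by (auto simp: separated_def)
qed

lemma partial_iso_forth:
  assumes ex: "exact m B E2 L2" and m: "Card_order m" and L1: "lim_rim B E1 L1"
    and G: "partial_iso B E1 L1 E2 L2 G" and card: "|G| <o m" and x: "x \<in> E1"
  shows "\<exists>y\<in>E2. partial_iso B E1 L1 E2 L2 (insert (x, y) G)"
proof -
  \<comment> \<open>The option type supplies an index outside \<open>G\<close> even if \<open>G\<close> exhausts its type.\<close>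
  let ?a = "\<lambda>o'. fst (the o')" and ?b = "\<lambda>o'. snd (the o')"
  have ab: "?a \<in> Some ` G \<rightarrow> E1" "?b \<in> Some ` G \<rightarrow> E2"
    using partial_iso_funcset[OF G] by auto
  have eq: "induced B E1 L1 (Some ` G) ?a = induced B E2 L2 (Some ` G) ?b"
    by (rule induced_reindex[OF partial_iso_funcset[OF G]])
      (use G in \<open>auto simp: partial_iso_def\<close>)
  obtain y where y: "y \<in> E2" and eq': "induced B E1 L1 (insert None (Some ` G)) (?a(None := x)) =
      induced B E2 L2 (insert None (Some ` G)) (?b(None := y))"
    using exact_realizes[OF ex m ordLeq_ordLess_trans[OF card_of_image card] _ L1 ab x eq, of None]
    by auto
  have "partial_iso B E1 L1 E2 L2 (insert (x, y) G)"
    by (rule partial_iso_reindex[OF _ _ eq', where h = "\<lambda>p. if p \<in> G then Some p else None"])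
      (use ab x y in auto)
  then show ?thesis using y by blast
qed

lemma partial_iso_back:
  assumes "exact m B E1 L1" "Card_order m" "lim_rim B E2 L2"
    and G: "partial_iso B E1 L1 E2 L2 G" and card: "|G| <o m" and y: "y \<in> E2"
  shows "\<exists>x\<in>E1. partial_iso B E1 L1 E2 L2 (insert (x, y) G)"
proof -
  have "G\<inverse> = prod.swap ` G" by force
  then have "|G\<inverse>| \<le>o |G|" using card_of_image[of prod.swap G] by simp
  then have "|G\<inverse>| <o m" using card by (rule ordLeq_ordLess_trans)
  then obtain x where "x \<in> E1" "partial_iso B E2 L2 E1 L1 (insert (y, x) (G\<inverse>))"
    using partial_iso_forth[OF assms(1-3) partial_iso_converse[OF G] _ y] by blast
  moreover have "(insert (y, x) (G\<inverse>))\<inverse> = insert (x, y) G" by auto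
  ultimately show ?thesis
    using partial_iso_converse[of B E2 L2 E1 L1 "insert (y, x) (G\<inverse>)"] by auto
qed

section \<open>Transfinite extension under a property of finite character\<close>

lemma finite_character_chain:
  assumes fc: "\<And>G. P G \<longleftrightarrow> (\<forall>F\<subseteq>G. finite F \<longrightarrow> P F)"
    and chain: "subset.chain UNIV \<C>" and ne: "\<C> \<noteq> {}" and P: "\<And>G. G \<in> \<C> \<Longrightarrow> P G"
  shows "P (\<Union>\<C>)"
proof (subst fc, intro allI impI)
  fix F assume "F \<subseteq> \<Union>\<C>" "finite F"
  then obtain G where "G \<in> \<C>" "F \<subseteq> G"
    using finite_subset_Union_chain[OF _ _ ne chain] by blast
  then show "P F" using P fc[of G] \<open>finite F\<close> by blast
qed

text \<open>
  The requirements \<open>W t\<close> are met one after the other along the cardinal well-order of \<open>T\<close>. As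
  \<open>|T| \<le> \<kappa>\<close>, its proper initial segments have fewer than \<open>\<kappa>\<close> elements, so each stage is small
  enough for the one-step extension.
\<close>

lemma finite_character_saturation:
  fixes T :: "'t set" and W :: "'t \<Rightarrow> 'a set" and \<kappa> :: "'k rel"
  assumes fc: "\<And>G. P G \<longleftrightarrow> (\<forall>F\<subseteq>G. finite F \<longrightarrow> P F)"
    and \<kappa>: "Card_order \<kappa>" "infinite (Field \<kappa>)" and T: "|T| \<le>o \<kappa>"
    and ext: "\<And>G t. P G \<Longrightarrow> |G| <o \<kappa> \<Longrightarrow> t \<in> T \<Longrightarrow> \<exists>q\<in>W t. P (insert q G)"
    and G0: "P G0" "|G0| <o \<kappa>"
  shows "\<exists>G. G0 \<subseteq> G \<and> P G \<and> (\<forall>t\<in>T. G \<inter> W t \<noteq> {})"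
proof -
  let ?r = "|T|"
  interpret wo_rel ?r using card_of_Well_order by (simp add: wo_rel_def)
  define step where
    "step p t = (SOME q. q \<in> W t \<and> P (insert q (G0 \<union> p ` underS t)))" for p t
  define p where "p = worec step"
  define H where "H A = G0 \<union> p ` A" for A
  have "adm_wo step"
    unfolding adm_wo_def
  proof (intro allI impI)
    fix f g :: "'t \<Rightarrow> 'a" and t assume "\<forall>s\<in>underS t. f s = g s"
    then have "f ` underS t = g ` underS t" by (intro image_cong) simp_all
    then show "step f t = step g t" by (simp add: step_def)
  qed
  then have rec: "p t = (SOME q. q \<in> W t \<and> P (insert q (H (underS t))))" for t
    using fun_cong[OF worec_fixpoint, of step t] unfolding p_def[symmetric] H_def
    by (simp add: step_def[of p])
  have limit: "P (H A)" if IH: "\<And>s. s \<in> A \<Longrightarrow> P (H (under s))" and A: "A \<subseteq> T"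
    and down: "\<And>s. s \<in> A \<Longrightarrow> under s \<subseteq> A" for A
  proof -
    let ?C = "insert G0 ((\<lambda>s. H (under s)) ` A)"
    have "under s \<subseteq> under s' \<or> under s' \<subseteq> under s" if "s \<in> A" "s' \<in> A" for s s'
    proof -
      have "(s, s') \<in> ?r \<or> (s', s) \<in> ?r" using that A TOTALS by (auto simp: Field_card_of)
      then show ?thesis using under_incr[OF TRANS] by blast
    qed
    then have "H (under s) \<subseteq> H (under s') \<or> H (under s') \<subseteq> H (under s)"
      if "s \<in> A" "s' \<in> A" for s s'
      using that unfolding H_def by blast
    then have "subset.chain UNIV ?C"
      unfolding subset_chain_def by (auto simp: H_def)
    then have "P (\<Union>?C)"
      using IH G0(1) by (intro finite_character_chain[of P, OF fc]) auto
    moreover have "s \<in> under s" if "s \<in> A" for s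
      using that A REFL by (auto simp: under_def refl_on_def Field_card_of)
    then have "\<Union>?C = H A" using down unfolding H_def by auto
    ultimately show ?thesis by simp
  qed
  have main: "t \<in> T \<longrightarrow> p t \<in> W t \<and> P (H (under t))" for t
  proof (rule well_order_induct[of "\<lambda>t. t \<in> T \<longrightarrow> p t \<in> W t \<and> P (H (under t))"], intro impI)
    fix t assume IH: "\<forall>s. s \<noteq> t \<and> (s, t) \<in> ?r \<longrightarrow> s \<in> T \<longrightarrow> p s \<in> W s \<and> P (H (under s))"
      and t: "t \<in> T"
    have uT: "underS t \<subseteq> T"
      using FieldI1[of _ t ?r] by (auto simp: underS_def Field_card_of)
    have "P (H (underS t))"
    proof (rule limit[OF _ uT])
      fix s assume s: "s \<in> underS t"
      then show "P (H (under s))" using IH uT by (auto simp: underS_def)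
      show "under s \<subseteq> underS t"
        using s TRANS ANTISYM by (auto simp: underS_def under_def dest: transD antisymD)
    qed
    moreover have "|underS t| <o \<kappa>"
      using card_of_underS[OF card_of_Card_order, of t T] t T
      by (auto simp: Field_card_of intro: ordLess_ordLeq_trans)
    then have "|p ` underS t| <o \<kappa>" using card_of_image ordLeq_ordLess_trans by blast
    then have "|H (underS t)| <o \<kappa>"
      unfolding H_def using card_of_Un_ordLess_infinite_Field \<kappa> G0(2) by blast
    ultimately have "\<exists>q. q \<in> W t \<and> P (insert q (H (underS t)))" using ext t by blast
    then have "p t \<in> W t \<and> P (insert (p t) (H (underS t)))"
      unfolding rec[of t] by (rule someI_ex)
    moreover have "under t = insert t (underS t)"
      using t REFL by (auto simp: underS_def under_def refl_on_def Field_card_of)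
    ultimately show "p t \<in> W t \<and> P (H (under t))" by (simp add: H_def)
  qed
  have "P (H T)"
  proof (rule limit)
    fix s assume "s \<in> T"
    then show "P (H (under s))" using main by blast
    show "under s \<subseteq> T" using FieldI1[of _ s ?r] by (auto simp: under_def Field_card_of)
  qed simp
  then show ?thesis
    using main by (intro exI[of _ "H T"]) (auto simp: H_def)
qed

section \<open>From partial isomorphisms to maps\<close>

lemma partial_iso_graph:
  assumes f: "f \<in> D \<rightarrow> E2" and D: "D \<subseteq> E1"
    and eq: "induced B E2 L2 D f = induced B E1 L1 D (\<lambda>e. e)"
  shows "partial_iso B E1 L1 E2 L2 ((\<lambda>x. (x, f x)) ` D)"
  by (rule partial_iso_reindex[where h = fst, OF _ f eq[symmetric]]) (use D in auto)

lemma partial_iso_total: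
  assumes G: "partial_iso B E1 L1 E2 L2 G" and L: "lim_rim B E1 L1" "lim_rim B E2 L2"
    and sep: "separated B E1 L1" "separated B E2 L2"
    and total: "\<And>x. x \<in> E1 \<Longrightarrow> \<exists>y. (x, y) \<in> G"
  obtains g where "G = (\<lambda>x. (x, g x)) ` E1" "inj_on g E1" "g \<in> E1 \<rightarrow> E2"
    "induced B E2 L2 E1 g = L1"
proof -
  obtain g where g: "\<And>x. x \<in> E1 \<Longrightarrow> (x, g x) \<in> G" using total by metis
  have sub: "G \<subseteq> E1 \<times> E2" using G by (simp add: partial_iso_def)
  have graph: "G = (\<lambda>x. (x, g x)) ` E1"
  proof (intro equalityI subsetI)
    fix p assume p: "p \<in> G"
    obtain x y where xy: "p = (x, y)" by (cases p)
    have "x \<in> E1" using p sub xy by blast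
    then have "y = g x" using partial_iso_functional[OF G L(1) sep(2)] p g xy by blast
    then show "p \<in> (\<lambda>x. (x, g x)) ` E1" using xy \<open>x \<in> E1\<close> by blast
  qed (use g in blast)
  have inj: "inj_on g E1"
  proof (rule inj_onI)
    fix x x' assume "x \<in> E1" "x' \<in> E1" "g x = g x'"
    then have "(g x, x) \<in> G\<inverse>" "(g x, x') \<in> G\<inverse>" using g[of x] g[of x'] by simp_all
    then show "x = x'" by (rule partial_iso_functional[OF partial_iso_converse[OF G] L(2) sep(1)])
  qed
  have gE: "g \<in> E1 \<rightarrow> E2" using g sub by auto
  have "induced B E1 L1 E1 (\<lambda>x. fst (x, g x)) = induced B E2 L2 E1 (\<lambda>x. snd (x, g x))"
    by (rule induced_reindex[OF partial_iso_funcset[OF G]])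
      (use g G in \<open>auto simp: partial_iso_def\<close>)
  then have "induced B E2 L2 E1 g = L1" using induced_id[OF L(1)] by simp
  then show thesis using that graph inj gE by blast
qed

lemma lim_rim_iso_sub_iff:
  assumes "E' \<subseteq> E"
  shows "lim_rim_iso B M LM E' (sub_ultrafilter B E L E') f \<longleftrightarrow>
    bij_betw f M E' \<and> induced B E L M f = LM"
proof -
  have "induced B E' (sub_ultrafilter B E L E') M f = induced B E L M f" if "bij_betw f M E'"
    unfolding sub_ultrafilter_def
    by (rule induced_induced) (use that assms in \<open>auto simp: bij_betw_def\<close>)
  then show ?thesis by (auto simp: lim_rim_iso_def)
qed

lemma lim_rim_embedding_iff:
  "lim_rim_embedding B M LM E L f \<longleftrightarrow> inj_on f M \<and> f \<in> M \<rightarrow> E \<and> induced B E L M f = LM"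
proof -
  have "lim_rim_embedding B M LM E L f \<longleftrightarrow>
      (\<exists>E'\<subseteq>E. bij_betw f M E' \<and> induced B E L M f = LM)"
    unfolding lim_rim_embedding_def using lim_rim_iso_sub_iff by metis
  then show ?thesis by (auto simp: bij_betw_def)
qed

section \<open>Universality and homogeneity\<close>

text \<open>The cardinal hypothesis turns the size of a regular lim-rim into the cardinal up to which it
  is exact.\<close>

lemma regular_lim_rim_card:
  assumes "|Pow (Pow B)| =o cardSuc |Pow B|" "regular_lim_rim B E L"
  shows "|E| =o cardSuc |Pow B|"
  using assms ordIso_transitive unfolding regular_lim_rim_def by blast

lemma Card_order_cardSuc_Pow: "Card_order (cardSuc |Pow B| )"
  by (rule cardSuc_Card_order[OF card_of_Card_order])

lemma infinite_Field_cardSuc_Pow: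
  "infinite B \<Longrightarrow> infinite (Field (cardSuc |Pow B| ))"
  by (simp add: cardSuc_finite[OF card_of_Card_order] Field_card_of)

lemma finite_less_cardSuc_Pow:
  assumes "infinite B" "finite F"
  shows "|F| <o cardSuc |Pow B|"
proof (rule finite_ordLess_infinite)
  show "Well_order |F|" by (rule card_of_Well_order)
  show "Well_order (cardSuc |Pow B| )"
    using Card_order_cardSuc_Pow by (rule card_order_on_well_order_on)
  show "finite (Field |F| )" using assms(2) by (simp add: Field_card_of)
  show "infinite (Field (cardSuc |Pow B| ))" by (rule infinite_Field_cardSuc_Pow[OF assms(1)])
qed

text \<open>As \<open>M\<close> need not be exact, points of \<open>M\<close> are matched with points of \<open>E\<close> but not conversely.\<close>

lemma embedding_extends:
  fixes E :: "'e set" and M :: "'m set"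
  assumes B: "infinite B" and ch: "|Pow (Pow B)| =o cardSuc |Pow B|"
    and reg: "regular_lim_rim B E L"
    and M: "lim_rim B M LM" "separated B M LM" "|M| \<le>o |E|"
    and G0: "partial_iso B M LM E L G0" "|G0| <o |E|"
  shows "\<exists>g. lim_rim_embedding B M LM E L g \<and> (\<forall>(x, y)\<in>G0. g x = y)"
proof -
  let ?\<kappa> = "cardSuc |Pow B|"
  have E: "lim_rim B E L" "separated B E L" "exact ?\<kappa> B E L"
    using reg by (auto simp: regular_lim_rim_def)
  note card = regular_lim_rim_card[OF ch reg]
  have "\<exists>G. G0 \<subseteq> G \<and> partial_iso B M LM E L G \<and> (\<forall>x\<in>M. G \<inter> {x} \<times> E \<noteq> {})"
  proof (rule finite_character_saturation[OF partial_iso_finite_character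
        Card_order_cardSuc_Pow infinite_Field_cardSuc_Pow[OF B] _ _ G0(1)])
    show "|M| \<le>o ?\<kappa>" using M(3) card by (rule ordLeq_ordIso_trans)
    show "|G0| <o ?\<kappa>" using G0(2) card by (rule ordLess_ordIso_trans)
    show "\<exists>q\<in>{x} \<times> E. partial_iso B M LM E L (insert q G)"
      if "partial_iso B M LM E L G" "|G| <o ?\<kappa>" "x \<in> M" for G x
      using partial_iso_forth[OF E(3) Card_order_cardSuc_Pow M(1) that] by auto
  qed
  then obtain G where G: "G0 \<subseteq> G" "partial_iso B M LM E L G" "\<forall>x\<in>M. G \<inter> {x} \<times> E \<noteq> {}"
    by blast
  obtain g where "G = (\<lambda>x. (x, g x)) ` M" "inj_on g M" "g \<in> M \<rightarrow> E" "induced B E L M g = LM"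
    by (rule partial_iso_total[OF G(2) M(1) E(1) M(2) E(2)]) (use G(3) in blast)+
  then show ?thesis using G(1) by (intro exI[of _ g]) (auto simp: lim_rim_embedding_iff)
qed

text \<open>Back and forth: the requirements are indexed by the disjoint sum of \<open>E1\<close> and \<open>E2\<close>.\<close>

lemma isomorphism_extends:
  fixes E1 :: "'e1 set" and E2 :: "'e2 set"
  assumes B: "infinite B" and ch: "|Pow (Pow B)| =o cardSuc |Pow B|"
    and reg: "regular_lim_rim B E1 L1" "regular_lim_rim B E2 L2"
    and G0: "partial_iso B E1 L1 E2 L2 G0" "|G0| <o cardSuc |Pow B|"
  shows "\<exists>g. lim_rim_iso B E1 L1 E2 L2 g \<and> (\<forall>(x, y)\<in>G0. g x = y)"
proof -
  let ?\<kappa> = "cardSuc |Pow B|"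
  let ?W = "case_sum (\<lambda>x. {x} \<times> E2) (\<lambda>y. E1 \<times> {y})"
  have E: "lim_rim B E1 L1" "separated B E1 L1" "exact ?\<kappa> B E1 L1"
      "lim_rim B E2 L2" "separated B E2 L2" "exact ?\<kappa> B E2 L2"
    using reg by (auto simp: regular_lim_rim_def)
  note inf = infinite_Field_cardSuc_Pow[OF B]
  note le = regular_lim_rim_card[OF ch reg(1), THEN ordIso_imp_ordLeq]
    regular_lim_rim_card[OF ch reg(2), THEN ordIso_imp_ordLeq]
  have "\<exists>G. G0 \<subseteq> G \<and> partial_iso B E1 L1 E2 L2 G \<and> (\<forall>t\<in>E1 <+> E2. G \<inter> ?W t \<noteq> {})"
  proof (rule finite_character_saturation[OF partial_iso_finite_character
        Card_order_cardSuc_Pow inf _ _ G0])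
    show "|E1 <+> E2| \<le>o ?\<kappa>"
      by (rule card_of_Plus_ordLeq_infinite_Field[OF inf le Card_order_cardSuc_Pow])
    show "\<exists>q\<in>?W t. partial_iso B E1 L1 E2 L2 (insert q G)"
      if "partial_iso B E1 L1 E2 L2 G" "|G| <o ?\<kappa>" "t \<in> E1 <+> E2" for G t
      using that partial_iso_forth[OF E(6) Card_order_cardSuc_Pow E(1) that(1,2)]
        partial_iso_back[OF E(3) Card_order_cardSuc_Pow E(4) that(1,2)]
      by (cases t) fastforce+
  qed
  then obtain G where G: "G0 \<subseteq> G" "partial_iso B E1 L1 E2 L2 G"
      "\<And>t. t \<in> E1 <+> E2 \<Longrightarrow> G \<inter> ?W t \<noteq> {}"
    by blast
  have tot: "\<exists>y. (x, y) \<in> G" if "x \<in> E1" for x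
    using G(3)[of "Inl x"] that by auto
  have sur: "\<exists>x. (x, y) \<in> G" if "y \<in> E2" for y
    using G(3)[of "Inr y"] that by auto
  obtain g where g: "G = (\<lambda>x. (x, g x)) ` E1" "inj_on g E1" "g \<in> E1 \<rightarrow> E2"
      "induced B E2 L2 E1 g = L1"
    using partial_iso_total[OF G(2) E(1,4,2,5) tot] by blast
  have "bij_betw g E1 E2"
    using g(1-3) sur unfolding bij_betw_def by fast
  then show ?thesis using g(1,4) G(1) by (intro exI[of _ g]) (auto simp: lim_rim_iso_def)
qed

lemma induced_empty:
  assumes "lim_rim B E L"
  shows "induced B E L {} \<eta> = {{\<lambda>_. undefined}}"
proof -
  have U: "ultrafilter_in ({} \<rightarrow>\<^sub>E B) (cylinders B {}) (induced B E L {} \<eta>)"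
    by (rule ultrafilter_induced[OF assms]) simp
  have "C = {} \<or> C = {\<lambda>_. undefined}" if "C \<in> induced B E L {} \<eta>" for C
    using that cylinders_subset[of C B "{}"] by (auto simp: induced_def)
  moreover have "{} \<notin> induced B E L {} \<eta>" "{\<lambda>_. undefined} \<in> induced B E L {} \<eta>"
    using U by (auto simp: ultrafilter_in_def)
  ultimately show ?thesis by blast
qed

lemma partial_iso_empty:
  assumes L: "lim_rim B E1 L1" "lim_rim B E2 L2"
  shows "partial_iso B E1 L1 E2 L2 {}"
  by (simp add: partial_iso_def induced_empty[OF L(1)] induced_empty[OF L(2)])

lemma mem_star_set_iff:
  "e \<in> star_set B E L A \<longleftrightarrow> e \<in> E \<and> {\<psi> \<in> E \<rightarrow>\<^sub>E B. \<psi> e \<in> A} \<in> L"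
  by (auto simp: star_set_def star_rel_def)

text \<open>A subset of \<open>B\<close> to the power of a one-point set amounts to a subset of \<open>B\<close>.\<close>

lemma partial_iso_singleton:
  assumes e: "e \<in> E" "e' \<in> E"
    and eq: "\<And>A. A \<subseteq> B \<Longrightarrow> e \<in> star_set B E L A \<longleftrightarrow> e' \<in> star_set B E L A"
  shows "partial_iso B E L E L {(e, e')}"
proof -
  have "C \<in> induced B E L {(e, e')} fst \<longleftrightarrow> C \<in> induced B E L {(e, e')} snd"
    if C: "C \<in> cylinders B {(e, e')}" for C
  proof -
    define A where "A = (\<lambda>\<phi>. \<phi> (e, e')) ` C"
    have sub: "C \<subseteq> {(e, e')} \<rightarrow>\<^sub>E B" by (rule cylinders_subset[OF C])
    have mem: "\<phi> \<in> C \<longleftrightarrow> \<phi> (e, e') \<in> A" if "\<phi> \<in> {(e, e')} \<rightarrow>\<^sub>E B" for \<phi>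
    proof
      assume "\<phi> (e, e') \<in> A"
      then obtain \<chi> where \<chi>: "\<chi> \<in> C" "\<phi> (e, e') = \<chi> (e, e')" by (auto simp: A_def)
      have "\<phi> = \<chi>"
        by (rule PiE_ext[OF that subsetD[OF sub \<chi>(1)]]) (simp add: \<chi>(2))
      then show "\<phi> \<in> C" using \<chi> by simp
    qed (simp add: A_def)
    have "C \<in> induced B E L {(e, e')} \<eta> \<longleftrightarrow> \<eta> (e, e') \<in> star_set B E L A"
      if "\<eta> (e, e') \<in> E" for \<eta>
    proof -
      have "compose {(e, e')} \<psi> \<eta> \<in> C \<longleftrightarrow> \<psi> (\<eta> (e, e')) \<in> A" if "\<psi> \<in> E \<rightarrow>\<^sub>E B" for \<psi>
        using mem[OF compose_PiE[of \<eta> _ E \<psi>]] that \<open>\<eta> (e, e') \<in> E\<close> by (simp add: compose_def)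
      then have "{\<psi> \<in> E \<rightarrow>\<^sub>E B. compose {(e, e')} \<psi> \<eta> \<in> C} = {\<psi> \<in> E \<rightarrow>\<^sub>E B. \<psi> (\<eta> (e, e')) \<in> A}"
        by blast
      then show ?thesis using C that by (simp add: induced_def mem_star_set_iff)
    qed
    moreover have "A \<subseteq> B" using sub by (auto simp: A_def)
    ultimately show ?thesis using eq e by simp
  qed
  then have "induced B E L {(e, e')} fst = induced B E L {(e, e')} snd"
    by (auto simp: induced_def)
  then show ?thesis using e by (simp add: partial_iso_def)
qed

theorem mainTheorem2:
  fixes B :: "'b set" and E :: "'e set" and L :: "('e \<Rightarrow> 'b) set set"
  assumes "infinite B"
    and "|Pow (Pow B)| =o cardSuc |Pow B|"
    and "regular_lim_rim B E L"
  shows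
    "exact |E| B E L
     \<and>
     (\<forall>(M :: 'm set) LM M' f.
        lim_rim B M LM \<and> separated B M LM \<and> |M| \<le>o |E| \<and> M' \<subseteq> M \<and> |M'| <o |E| \<and>
        lim_rim_embedding B M' (sub_ultrafilter B M LM M') E L f
        \<longrightarrow> (\<exists>g. lim_rim_embedding B M LM E L g \<and> (\<forall>x\<in>M'. g x = f x)))
     \<and>
     (\<forall>(E1 :: 'e1 set) L1 (E2 :: 'e2 set) L2 E1' E2' f.
        regular_lim_rim B E1 L1 \<and> regular_lim_rim B E2 L2 \<and>
        E1' \<subseteq> E1 \<and> E2' \<subseteq> E2 \<and> |E1'| <o |Pow (Pow B)| \<and> |E2'| <o |Pow (Pow B)| \<and>
        lim_rim_iso B E1' (sub_ultrafilter B E1 L1 E1') E2' (sub_ultrafilter B E2 L2 E2') f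
        \<longrightarrow> (\<exists>g. lim_rim_iso B E1 L1 E2 L2 g \<and> (\<forall>x\<in>E1'. g x = f x)))
     \<and>
     (\<forall>(E1 :: 'e1 set) L1 (E2 :: 'e2 set) L2.
        regular_lim_rim B E1 L1 \<and> regular_lim_rim B E2 L2
        \<longrightarrow> (\<exists>f. lim_rim_iso B E1 L1 E2 L2 f))
     \<and>
     (\<forall>e\<in>E. \<forall>e'\<in>E.
        {A. A \<subseteq> B \<and> e \<in> star_set B E L A} = {A. A \<subseteq> B \<and> e' \<in> star_set B E L A}
        \<longrightarrow> (\<exists>f. lim_rim_iso B E L E L f \<and> f e = e'))"
proof (intro conjI)
  let ?\<kappa> = "cardSuc |Pow B|"
  note B = assms(1) and ch = assms(2) and reg = assms(3)
  show "exact |E| B E L"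
  proof (rule exact_transfer[OF _ Card_order_cardSuc_Pow])
    show "exact ?\<kappa> B E L" using reg by (simp add: regular_lim_rim_def)
    show "|E| \<le>o ?\<kappa>" using regular_lim_rim_card[OF ch reg] by (rule ordIso_imp_ordLeq)
  qed
  show "\<forall>(M :: 'm set) LM M' f.
        lim_rim B M LM \<and> separated B M LM \<and> |M| \<le>o |E| \<and> M' \<subseteq> M \<and> |M'| <o |E| \<and>
        lim_rim_embedding B M' (sub_ultrafilter B M LM M') E L f
        \<longrightarrow> (\<exists>g. lim_rim_embedding B M LM E L g \<and> (\<forall>x\<in>M'. g x = f x))"
  proof (intro allI impI, elim conjE)
    fix M :: "'m set" and LM M' f
    assume M: "lim_rim B M LM" "separated B M LM" "|M| \<le>o |E|" and M': "M' \<subseteq> M" "|M'| <o |E|"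
      and f: "lim_rim_embedding B M' (sub_ultrafilter B M LM M') E L f"
    let ?G0 = "(\<lambda>x. (x, f x)) ` M'"
    have G0: "partial_iso B M LM E L ?G0"
      using f M'(1) unfolding lim_rim_embedding_iff sub_ultrafilter_def
      by (intro partial_iso_graph) auto
    have card: "|?G0| <o |E|" using card_of_image M'(2) by (rule ordLeq_ordLess_trans)
    show "\<exists>g. lim_rim_embedding B M LM E L g \<and> (\<forall>x\<in>M'. g x = f x)"
      using embedding_extends[OF B ch reg M G0 card] by simp
  qed
  show "\<forall>(E1 :: 'e1 set) L1 (E2 :: 'e2 set) L2 E1' E2' f.
        regular_lim_rim B E1 L1 \<and> regular_lim_rim B E2 L2 \<and>
        E1' \<subseteq> E1 \<and> E2' \<subseteq> E2 \<and> |E1'| <o |Pow (Pow B)| \<and> |E2'| <o |Pow (Pow B)| \<and>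
        lim_rim_iso B E1' (sub_ultrafilter B E1 L1 E1') E2' (sub_ultrafilter B E2 L2 E2') f
        \<longrightarrow> (\<exists>g. lim_rim_iso B E1 L1 E2 L2 g \<and> (\<forall>x\<in>E1'. g x = f x))"
  proof (intro allI impI, elim conjE)
    fix E1 :: "'e1 set" and L1 and E2 :: "'e2 set" and L2 E1' E2' f
    assume regs: "regular_lim_rim B E1 L1" "regular_lim_rim B E2 L2"
      and sub: "E1' \<subseteq> E1" "E2' \<subseteq> E2" and small: "|E1'| <o |Pow (Pow B)|"
      and f: "lim_rim_iso B E1' (sub_ultrafilter B E1 L1 E1') E2' (sub_ultrafilter B E2 L2 E2') f"
    let ?G0 = "(\<lambda>x. (x, f x)) ` E1'"
    have bij: "bij_betw f E1' E2'" and eq: "induced B E2 L2 E1' f = induced B E1 L1 E1' (\<lambda>e. e)"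
      using f unfolding lim_rim_iso_sub_iff[OF sub(2)] unfolding sub_ultrafilter_def
      by (rule conjunct1, rule conjunct2)
    have fE: "f \<in> E1' \<rightarrow> E2"
    proof (rule funcsetI)
      fix x assume "x \<in> E1'"
      then show "f x \<in> E2" using bij_betwE[OF bij] sub(2) by blast
    qed
    have G0: "partial_iso B E1 L1 E2 L2 ?G0" by (rule partial_iso_graph[OF fE sub(1) eq])
    have card: "|?G0| <o ?\<kappa>"
      using ordLeq_ordLess_trans[OF card_of_image small] ch by (rule ordLess_ordIso_trans)
    show "\<exists>g. lim_rim_iso B E1 L1 E2 L2 g \<and> (\<forall>x\<in>E1'. g x = f x)"
      using isomorphism_extends[OF B ch regs G0 card] by simp
  qed
  show "\<forall>(E1 :: 'e1 set) L1 (E2 :: 'e2 set) L2.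
        regular_lim_rim B E1 L1 \<and> regular_lim_rim B E2 L2
        \<longrightarrow> (\<exists>f. lim_rim_iso B E1 L1 E2 L2 f)"
  proof (intro allI impI, elim conjE)
    fix E1 :: "'e1 set" and L1 and E2 :: "'e2 set" and L2
    assume regs: "regular_lim_rim B E1 L1" "regular_lim_rim B E2 L2"
    then have empty: "partial_iso B E1 L1 E2 L2 {}"
      by (intro partial_iso_empty) (auto simp: regular_lim_rim_def)
    show "\<exists>f. lim_rim_iso B E1 L1 E2 L2 f"
      using isomorphism_extends[OF B ch regs empty finite_less_cardSuc_Pow[OF B]] by auto
  qed
  show "\<forall>e\<in>E. \<forall>e'\<in>E.
        {A. A \<subseteq> B \<and> e \<in> star_set B E L A} = {A. A \<subseteq> B \<and> e' \<in> star_set B E L A}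
        \<longrightarrow> (\<exists>f. lim_rim_iso B E L E L f \<and> f e = e')"
  proof (intro ballI impI)
    fix e e' assume e: "e \<in> E" "e' \<in> E"
      and "{A. A \<subseteq> B \<and> e \<in> star_set B E L A} = {A. A \<subseteq> B \<and> e' \<in> star_set B E L A}"
    then have G0: "partial_iso B E L E L {(e, e')}"
      by (intro partial_iso_singleton) auto
    show "\<exists>f. lim_rim_iso B E L E L f \<and> f e = e'"
      using isomorphism_extends[OF B ch reg reg G0 finite_less_cardSuc_Pow[OF B]] by simp
  qed
qed

end
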